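(* Let $n,s,u$ be positive integers with $s\leq n$, and let $\mathcal{F} \subseteq \binom{[n]}{\leq u}$ be $(2,s)$-conditionally intersecting. (i) If $u \geq s - 1$ and $s = 2k$ for an integer $k$, then \[ |\mathcal{F}|\leq \binom{n-1}{k-1}+\sum_{i=k+1}^u\binom{n}{i}, \] and if $s < n$ also holds, then equality holds if and only if, up to isomorphism (i.e. up to a permutation of $[n]$), \[ \mathcal{F} = \{ F\in 2^{[n]} : k<|F|\leq u \} \cup \left\{ F\in \binom{[n]}{k} : 1\in F\right\}. \] (ii) If $u \geq s - 1$ and $s = 2k - 1$ for an integer $k$, then \[ |\mathcal{F}|\leq \sum_{i=k}^u \binom{n}{i}, \] and if $s < n$ also holds, then equality holds if and only if \[ \mathcal{F} = \{ F\in 2^{[n]} : k\leq |F|\leq u \}. \] (iii) If $u \leq \left\lfloor\frac{s}{2}\right\rfloor$, then \[ |\mathcal{F}| \leq \sum_{r=1}^{u}\binom{n-1}{r-1}, \] and equality holds if and only if, up to isomorphism, \[ \mathcal{F} = \{ F\in 2^{[n]} : 1\leq |F|\leq u \text{ and } 1\in F\}. \]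
   Context: $[n]=\{1,\ldots,n\}$, $2^{[n]}$ is its power set, $\binom{[n]}{k}$ is the family of all $k$-element subsets of $[n]$, and $\binom{[n]}{\leq u} = \{X\subseteq[n] : |X|\leq u\}$. A family $\mathcal{F} \subseteq 2^{[n]}$ is $(2,s)$-conditionally intersecting if, for each $A,B\in\mathcal{F}$ (not required to be distinct), $A \cap B \neq \emptyset$ whenever $|A \cup B| \leq s$. In particular, such a family does not contain the empty set. *)

theory Defs
  imports Main "HOL-Combinatorics.Permutations"
begin

definition ksubsets :: "nat \<Rightarrow> nat \<Rightarrow> nat set set" where
  "ksubsets n k = {X \<in> Pow {1..n}. card X = k}"

definition subsets_upto :: "nat \<Rightarrow> nat \<Rightarrow> nat set set" where
  "subsets_upto n u = {X \<in> Pow {1..n}. card X \<le> u}"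

(* A and B need not be distinct, so the empty set is never a member.
   Meant for families of finite sets only (card is 0 on infinite sets). *)
definition cond_intersecting :: "nat \<Rightarrow> 'a set set \<Rightarrow> bool" where
  "cond_intersecting s \<F> \<longleftrightarrow>
     (\<forall>A\<in>\<F>. \<forall>B\<in>\<F>. card (A \<union> B) \<le> s \<longrightarrow> A \<inter> B \<noteq> {})"

definition family_iso :: "nat \<Rightarrow> nat set set \<Rightarrow> nat set set \<Rightarrow> bool" where
  "family_iso n \<F> \<G> \<longleftrightarrow> (\<exists>p. p permutes {1..n} \<and> \<F> = (\<lambda>X. p ` X) ` \<G>)"

end

theory Submission
  imports Defs "HOL-Combinatorics.Multiset_Permutations"
begin

text \<open>
  Sets of sizes \<open>s - j < j\<close> with \<open>j \<le> s - 1\<close> lie in levels that cross-intersect, so double counting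
  the disjoint pairs shows that the levels \<open>s - j\<close> and \<open>j\<close> together contain at most
  \<open>n choose j\<close> members, and for \<open>s < n\<close> equality leaves only the full level \<open>j\<close>. A level \<open>k\<close> with
  \<open>2 k \<le> s\<close> is intersecting, so the Erdos-Ko-Rado theorem bounds it. Katona's
  cycle argument proves that theorem: a cyclic order of the ground set contains at most \<open>k\<close> arcs from
  the family. In the case of equality every cyclic order contains exactly \<open>k\<close> of them, which yields
  an exchange property on sets. For \<open>2 k < n\<close> this property gives two members that meet in a single
  point \<open>x\<close>, then all \<open>k\<close>-subsets of their union that contain \<open>x\<close>, and finally that the family is
  a star. In (iii) equality needs no uniqueness theorem, since it forces a singleton into the family.
\<close>

subsection \<open>The Erdos-Ko-Rado theorem\<close>

lemma card_star:
  assumes "finite V" and "x \<in> V"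
  shows "card {A. A \<subseteq> V \<and> card A = Suc r \<and> x \<in> A} = (card V - 1) choose r"
proof -
  have "bij_betw (insert x) {A. A \<subseteq> V - {x} \<and> card A = r} {A. A \<subseteq> V \<and> card A = Suc r \<and> x \<in> A}"
  proof (rule bij_betw_byWitness[where f' = "\<lambda>A. A - {x}"])
    show "insert x ` {A. A \<subseteq> V - {x} \<and> card A = r} \<subseteq> {A. A \<subseteq> V \<and> card A = Suc r \<and> x \<in> A}"
    proof clarify
      fix A assume A: "A \<subseteq> V - {x}"
      then have "finite A" using assms(1) finite_subset by blast
      then show "insert x A \<subseteq> V \<and> card (insert x A) = Suc (card A) \<and> x \<in> insert x A"
        using A assms(2) by (subst card_insert_disjoint) auto
    qed
  qed auto
  from bij_betw_same_card[OF this] show ?thesis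
    using assms by (simp add: n_subsets)
qed

text \<open>The second arc occupies positions \<open>d\<close> to \<open>d + k - 1\<close>:
  \<open>k \<le> d\<close> puts it after the first arc, and \<open>d + k \<le> length xs\<close>
  keeps it from wrapping around.\<close>

lemma set_take_rotate_disjoint:
  assumes "distinct xs" and "k \<le> d" and "d + k \<le> length xs"
  shows "set (take k xs) \<inter> set (take k (rotate d xs)) = {}"
proof -
  \<comment> \<open>\<open>rotate_drop_take\<close> reduces \<open>d\<close> modulo the length, so
    \<open>d = length xs\<close> is a separate case.\<close>
  have "rotate d xs = drop d xs @ take d xs"
    using assms by (cases "d = length xs") (simp_all add: rotate_drop_take)
  then have "set (take k (rotate d xs)) = set (take k (drop d xs))"
    using assms by simp
  also have "\<dots> \<subseteq> set (drop k xs)"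
    using set_drop_subset_set_drop[OF assms(2)] set_take_subset by fastforce
  finally show ?thesis
    using set_take_disj_set_drop_if_distinct[OF assms(1) order_refl[of k]] by blast
qed

text \<open>Such an ordering is an ordering of \<open>A\<close> followed by an ordering of
  \<open>V - A\<close>.\<close>

lemma card_permutations_take_eq:
  assumes "finite V" and "A \<subseteq> V" and "card A = k"
  shows "card {xs \<in> permutations_of_set V. set (take k xs) = A} = fact k * fact (card V - k)"
proof -
  have "finite A" using assms finite_subset by blast
  have "bij_betw (\<lambda>(ys, zs). ys @ zs) (permutations_of_set A \<times> permutations_of_set (V - A))
      {xs \<in> permutations_of_set V. set (take k xs) = A}"
  proof (rule bij_betw_byWitness[where f' = "\<lambda>xs. (take k xs, drop k xs)"])
    show "(\<lambda>xs. (take k xs, drop k xs)) ` {xs \<in> permutations_of_set V. set (take k xs) = A}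
        \<subseteq> permutations_of_set A \<times> permutations_of_set (V - A)"
    proof clarsimp
      fix xs assume xs: "xs \<in> permutations_of_set V" and A: "A = set (take k xs)"
      have d: "distinct xs" "set xs = V" using xs by (auto simp: permutations_of_set_def)
      have "set (take k xs) \<union> set (drop k xs) = V"
        by (metis append_take_drop_id d(2) set_append)
      moreover have "set (take k xs) \<inter> set (drop k xs) = {}"
        using set_take_disj_set_drop_if_distinct[OF d(1) order_refl[of k]] .
      ultimately show "take k xs \<in> permutations_of_set (set (take k xs)) \<and>
          drop k xs \<in> permutations_of_set (V - set (take k xs))"
        using d by (auto simp: permutations_of_set_def)
    qed
  qed (use assms in \<open>auto simp: permutations_of_set_def distinct_card\<close>)
  from bij_betw_same_card[OF this] show ?thesis
    using assms \<open>finite A\<close> by (simp add: card_cartesian_product card_Diff_subset)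
qed

section \<open>Katona's cycle argument: the bound\<close>

locale uniform_intersecting =
  fixes V :: "'a set" and F :: "'a set set" and k :: nat
  assumes finite_V: "finite V"
    and subset_V: "\<And>A. A \<in> F \<Longrightarrow> A \<subseteq> V"
    and card_member: "\<And>A. A \<in> F \<Longrightarrow> card A = k"
    and meet: "\<And>A B. A \<in> F \<Longrightarrow> B \<in> F \<Longrightarrow> A \<inter> B \<noteq> {}"
    and k_pos: "0 < k"
    and card_V: "2 * k \<le> card V"
begin

text \<open>A cyclic order is represented by any list that cuts it open. Arcs are recorded by their
  starting positions, and \<open>rotate\<close> takes care of those that wrap around.\<close>

definition arcs :: "'a list \<Rightarrow> nat set" where
  "arcs xs = {i. i < card V \<and> set (take k (rotate i xs)) \<in> F}"

lemma finite_arcs: "finite (arcs xs)"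
  by (simp add: arcs_def)

lemma finite_F: "finite F"
  by (rule finite_subset[of _ "Pow V"]) (use finite_V subset_V in auto)

lemma arcs_apart:
  assumes xs: "xs \<in> permutations_of_set V"
    and F: "set (take k (rotate i xs)) \<in> F" "set (take k (rotate (i + d) xs)) \<in> F"
    and d: "k \<le> d" "d + k \<le> card V"
  shows False
proof -
  have "distinct xs" "length xs = card V"
    using xs by (auto simp: permutations_of_set_def distinct_card)
  then have "set (take k (rotate i xs)) \<inter> set (take k (rotate d (rotate i xs))) = {}"
    using d by (intro set_take_rotate_disjoint) auto
  then show False using meet[OF F] by (simp add: rotate_rotate add.commute)
qed

text \<open>The arc starting at \<open>i\<close> and the one ending just before \<open>i\<close> are disjoint, and every other
  arc meeting the initial one is of one of these two forms for some \<open>i\<close> with \<open>0 < i < k\<close>.\<close>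

lemma arcs_initial:
  assumes xs: "xs \<in> permutations_of_set V" and init: "set (take k xs) \<in> F"
  shows "card (arcs xs) \<le> k"
    and "card (arcs xs) = k \<Longrightarrow> 0 < i \<Longrightarrow> i < k \<Longrightarrow> i \<in> arcs xs \<or> i + (card V - k) \<in> arcs xs"
proof -
  define J where "J = arcs xs \<inter> {0<..<k}"
  \<comment> \<open>From each of the \<open>k - 1\<close> pairs \<open>i\<close>,
    \<open>i + (card V - k)\<close> of starts of disjoint arcs, \<open>U\<close> takes
    \<open>i\<close> if it lies in \<open>arcs xs\<close> and the other index otherwise. With the
    index \<open>0\<close> this makes at most \<open>k\<close>.\<close>
  define U where "U = insert 0 (J \<union> (\<lambda>i. i + (card V - k)) ` ({0<..<k} - J))"
  have sub: "arcs xs \<subseteq> U"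
  proof
    fix i assume i: "i \<in> arcs xs"
    then have iF: "set (take k (rotate i xs)) \<in> F" "i < card V" by (auto simp: arcs_def)
    have "\<not> (k \<le> i \<and> i + k \<le> card V)"
      using arcs_apart[OF xs, of 0 i] init iF by auto
    then consider "i = 0" | "0 < i" "i < k" | "card V - k < i" "k \<le> i" by linarith
    then show "i \<in> U"
    proof cases
      case 3
      define j where "j = i - (card V - k)"
      have j: "0 < j" "j < k" "i = j + (card V - k)" using 3 iF card_V by (auto simp: j_def)
      have "j \<notin> J"
      proof
        assume "j \<in> J"
        then have "set (take k (rotate j xs)) \<in> F" by (auto simp: J_def arcs_def)
        then show False
        proof (rule arcs_apart[OF xs])
          show "set (take k (rotate (j + (card V - k)) xs)) \<in> F" using iF j by simp
        qed (use card_V in linarith)+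
      qed
      then show ?thesis using j by (auto simp: U_def)
    qed (use i in \<open>auto simp: U_def J_def\<close>)
  qed
  have "card U \<le> Suc (card J + card ({0<..<k} - J))"
    unfolding U_def
    by (rule order_trans[OF card_insert_le_m1])
       (auto intro!: order_trans[OF card_Un_le] card_image_le add_mono)
  also have "card J + card ({0<..<k} - J) = card {0<..<k}"
    by (rule card_Un_disjoint[symmetric, THEN trans]) (auto simp: J_def finite_arcs intro!: arg_cong[of _ _ card])
  finally have cU: "card U \<le> k" using k_pos by simp
  have fU: "finite U" by (auto simp: U_def J_def finite_arcs)
  show "card (arcs xs) \<le> k" using card_mono[OF fU sub] cU by simp
  show "i \<in> arcs xs \<or> i + (card V - k) \<in> arcs xs" if "card (arcs xs) = k" "0 < i" "i < k"
  proof -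
    have "arcs xs = U" using card_seteq[OF fU sub] cU that by simp
    then show ?thesis using that by (auto simp: U_def)
  qed
qed

lemma rotate_perm: "xs \<in> permutations_of_set V \<Longrightarrow> rotate i xs \<in> permutations_of_set V"
  by (simp add: permutations_of_set_def)

text \<open>Rotating the list only shifts the starting positions. Hence any arc in \<open>F\<close>
  can be made the initial one, as \<open>arcs_initial\<close> requires.\<close>

lemma card_arcs_rotate:
  assumes xs: "xs \<in> permutations_of_set V" and j: "j < card V"
  shows "card (arcs xs) \<le> card (arcs (rotate j xs))"
proof -
  let ?n = "card V"
  have len: "length xs = ?n" using xs by (auto simp: permutations_of_set_def distinct_card)
  have "arcs xs \<subseteq> (\<lambda>i. (i + j) mod ?n) ` arcs (rotate j xs)"
  proof
    fix i assume i: "i \<in> arcs xs"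
    then have iF: "i < ?n" "set (take k (rotate i xs)) \<in> F" by (auto simp: arcs_def)
    \<comment> \<open>This is \<open>i - j\<close> modulo \<open>card V\<close>, written without
      negative numbers.\<close>
    define m where "m = (if j \<le> i then i - j else i + ?n - j)"
    have m: "m < ?n" "(m + j) mod ?n = i" using iF j by (auto simp: m_def)
    have "rotate m (rotate j xs) = rotate i xs"
      using m(2) len rotate_conv_mod[of "m + j" xs] by (simp add: rotate_rotate)
    then have "m \<in> arcs (rotate j xs)" using m(1) iF by (simp add: arcs_def)
    then show "i \<in> (\<lambda>i. (i + j) mod ?n) ` arcs (rotate j xs)" using m(2) by blast
  qed
  then show ?thesis by (rule surj_card_le[OF finite_arcs])
qed

lemma card_arcs_le:
  assumes xs: "xs \<in> permutations_of_set V"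
  shows "card (arcs xs) \<le> k"
proof (cases "arcs xs = {}")
  case False
  then obtain j where "j < card V" "set (take k (rotate j xs)) \<in> F" by (auto simp: arcs_def)
  then show ?thesis
    using card_arcs_rotate[OF xs] arcs_initial(1)[OF rotate_perm[OF xs]] order_trans by blast
qed simp

text \<open>Double counting of pairs of an ordering and a starting position. Rotation permutes the
  orderings, so every position contributes as much as position \<open>0\<close>, where
  \<open>card_permutations_take_eq\<close> counts the orderings for each member.\<close>

lemma sum_card_arcs:
  "(\<Sum>xs\<in>permutations_of_set V. card (arcs xs)) = card V * (card F * (fact k * fact (card V - k)))"
proof -
  let ?P = "permutations_of_set V"
  have fP: "finite ?P" by simp
  have "(\<Sum>xs\<in>?P. card (arcs xs)) =
      (\<Sum>xs\<in>?P. \<Sum>i<card V. if set (take k (rotate i xs)) \<in> F then 1 else 0)"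
    by (intro sum.cong refl) (simp add: arcs_def sum.If_cases Int_def)
  also have "\<dots> = (\<Sum>i<card V. \<Sum>xs\<in>?P. if set (take k (rotate i xs)) \<in> F then 1 else 0)"
    by (rule sum.swap)
  also have "\<dots> = (\<Sum>i<card V. \<Sum>xs\<in>?P. if set (take k xs) \<in> F then 1 else 0)"
  proof (rule sum.cong[OF refl])
    fix i assume i: "i \<in> {..<card V}"
    have inj: "inj_on (rotate i) ?P"
    proof (rule inj_on_inverseI)
      fix xs assume "xs \<in> ?P"
      then show "rotate (card V - i) (rotate i xs) = xs"
        using i by (simp add: rotate_rotate length_finite_permutations_of_set)
    qed
    have "rotate i ` ?P = ?P"
      by (rule endo_inj_surj[OF fP _ inj]) (auto simp: rotate_perm)
    then have "bij_betw (rotate i) ?P ?P" using inj by (simp add: bij_betw_def)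
    from sum.reindex_bij_betw[OF this, of "\<lambda>xs. if set (take k xs) \<in> F then 1 else 0"]
    show "(\<Sum>xs\<in>?P. if set (take k (rotate i xs)) \<in> F then 1 else 0) =
        (\<Sum>xs\<in>?P. if set (take k xs) \<in> F then 1 else 0 :: nat)" .
  qed
  also have "\<dots> = card V * card {xs \<in> ?P. set (take k xs) \<in> F}"
    by (simp add: sum.If_cases Int_def)
  also have "{xs \<in> ?P. set (take k xs) \<in> F} = (\<Union>A\<in>F. {xs \<in> ?P. set (take k xs) = A})"
    by blast
  also have "card \<dots> = (\<Sum>A\<in>F. card {xs \<in> ?P. set (take k xs) = A})"
    by (rule card_UN_disjoint) (auto simp: finite_F)
  also have "\<dots> = card F * (fact k * fact (card V - k))"
    using card_permutations_take_eq[OF finite_V subset_V card_member] by simp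
  finally show ?thesis .
qed

text \<open>This writes \<open>k * fact (card V)\<close> with the factors of
  \<open>sum_card_arcs\<close>, so that comparing the two sums compares \<open>card F\<close> with
  the binomial coefficient.\<close>

lemma sum_card_arcs_bound:
  "(\<Sum>xs\<in>permutations_of_set V. k) =
    card V * (((card V - 1) choose (k - 1)) * (fact k * fact (card V - k)))"
proof -
  obtain m where m: "card V = Suc m" using card_V k_pos by (cases "card V") auto
  obtain l where l: "k = Suc l" using k_pos by (cases k) auto
  have "fact l * fact (m - l) * (m choose l) = (fact m :: nat)"
    using card_V m l by (intro binomial_fact_lemma) auto
  then show ?thesis using finite_V by (simp add: m l algebra_simps)
qed

lemma card_le: "card F \<le> (card V - 1) choose (k - 1)"
proof -
  have "(\<Sum>xs\<in>permutations_of_set V. card (arcs xs)) \<le> (\<Sum>xs\<in>permutations_of_set V. k)"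
    by (rule sum_mono) (rule card_arcs_le)
  then show ?thesis unfolding sum_card_arcs sum_card_arcs_bound using card_V k_pos by auto
qed

end

section \<open>The case of equality in the Erdos-Ko-Rado theorem\<close>

locale extremal_intersecting = uniform_intersecting +
  assumes card_F: "card F = (card V - 1) choose (k - 1)"
begin

lemma card_arcs_eq:
  assumes "xs \<in> permutations_of_set V"
  shows "card (arcs xs) = k"
proof (rule sum_mono_inv[OF _ card_arcs_le assms])
  show "(\<Sum>xs\<in>permutations_of_set V. card (arcs xs)) = (\<Sum>xs\<in>permutations_of_set V. k)"
    unfolding sum_card_arcs sum_card_arcs_bound card_F ..
qed auto

text \<open>In a cyclic order that runs through \<open>P\<close>, \<open>Q\<close>, \<open>R\<close>, the remaining points and \<open>T\<close>, the sets
  \<open>Q \<union> R\<close> and \<open>T \<union> P\<close> are the two disjoint arcs that start and end between \<open>P\<close> and \<open>Q\<close>.\<close>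

lemma exchange:
  assumes PQ: "P \<union> Q \<in> F" "P \<inter> Q = {}" "P \<noteq> {}" "Q \<noteq> {}"
    and R: "R \<subseteq> V" "R \<inter> (P \<union> Q) = {}" "card R = card P"
    and T: "T \<subseteq> V" "T \<inter> (P \<union> Q) = {}" "T \<inter> R = {}" "card T = card Q"
  shows "Q \<union> R \<in> F \<or> P \<union> T \<in> F"
proof -
  have PQV: "P \<union> Q \<subseteq> V" using PQ subset_V by blast
  then have fin: "finite P" "finite Q" "finite R" "finite T"
    using R T finite_V by (auto intro: finite_subset)
  have k: "card P + card Q = k"
    using card_member[OF PQ(1)] PQ(2) fin by (simp add: card_Un_disjoint)
  define Z where "Z = V - (P \<union> Q \<union> R \<union> T)"
  obtain p q r t z where l: "set p = P" "distinct p" "set q = Q" "distinct q" "set r = R" "distinct r"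
    "set t = T" "distinct t" "set z = Z" "distinct z"
    using fin finite_V finite_distinct_list[of P] finite_distinct_list[of Q]
      finite_distinct_list[of R] finite_distinct_list[of T] finite_distinct_list[of Z]
    unfolding Z_def by (metis finite_Diff)
  have len: "length p = card P" "length q = card Q" "length r = card R" "length t = card T"
    using l by (auto simp: distinct_card[symmetric])
  define xs where "xs = p @ q @ r @ z @ t"
  have xs: "xs \<in> permutations_of_set V"
    using l PQ R T PQV by (auto simp: xs_def Z_def permutations_of_set_def)
  then have "length xs = card V" by (auto simp: permutations_of_set_def distinct_card)
  then have lenz: "length (p @ q @ r @ z) = card P + (card V - k)"
    using len k R T by (simp add: xs_def)
  have "set (take k xs) \<in> F" using PQ(1) k len l by (simp add: xs_def)
  \<comment> \<open>Since \<open>P\<close> and \<open>Q\<close> are nonempty, \<open>card P\<close>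
    lies strictly between \<open>0\<close> and \<open>k\<close>. Its partner
    \<open>card P + (card V - k)\<close> is the position where \<open>t\<close> begins, because
    \<open>card T = card Q\<close>.\<close>
  from arcs_initial(2)[OF xs this card_arcs_eq[OF xs], of "card P"]
  have "card P \<in> arcs xs \<or> card P + (card V - k) \<in> arcs xs"
    using PQ fin k card_gt_0_iff[of P] card_gt_0_iff[of Q] by linarith
  moreover have "rotate (card P) xs = q @ r @ z @ t @ p"
    using rotate_append[of p "q @ r @ z @ t"] len by (simp add: xs_def)
  moreover have "rotate (card P + (card V - k)) xs = t @ p @ q @ r @ z"
    using rotate_append[of "p @ q @ r @ z" t] lenz by (simp add: xs_def)
  ultimately show ?thesis using len k l R T by (auto simp: arcs_def Un_commute)
qed

lemma finite_subset_V: "A \<subseteq> V \<Longrightarrow> finite A"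
  using finite_V finite_subset by blast

text \<open>Fix \<open>A\<close> and let \<open>B\<close> minimise the intersection with
  \<open>A\<close>. If they share more than a point \<open>q\<close>, \<open>exchange\<close> splits
  \<open>A\<close> so that \<open>Q\<close> is the rest of the intersection: one outcome meets
  \<open>A\<close> only in \<open>Q\<close>, against minimality, and the other meets
  \<open>B\<close> only in \<open>q\<close>.\<close>

lemma meet_in_one_point:
  obtains A B x where "A \<in> F" "B \<in> F" "A \<inter> B = {x}"
proof -
  have "card F \<noteq> 0" using card_F card_V k_pos by auto
  then obtain A where A: "A \<in> F" by fastforce
  have finA: "finite A" using A subset_V finite_subset_V by blast
  obtain B where B: "B \<in> F" and min: "\<And>C. C \<in> F \<Longrightarrow> card (A \<inter> B) \<le> card (A \<inter> C)"
    using ex_has_least_nat[of "\<lambda>C. C \<in> F" A "\<lambda>C. card (A \<inter> C)"] A by blast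
  have finB: "finite B" using B subset_V finite_subset_V by blast
  obtain q where q: "q \<in> A \<inter> B" using meet[OF A B] by blast
  show thesis
  proof (cases "A \<inter> B = {q}")
    case False
    define Q where "Q = A \<inter> B - {q}"
    define P where "P = A - Q"
    have Q: "Q \<noteq> {}" using False q by (auto simp: Q_def)
    have PQ: "P \<union> Q = A" "P \<inter> Q = {}" "q \<in> P" using q by (auto simp: P_def Q_def)
    have cQ: "Suc (card Q) = card (A \<inter> B)"
      unfolding Q_def using q finA by (intro card_Suc_Diff1) auto
    have cP: "card P + card Q = k"
      using PQ finA card_member[OF A] by (metis card_Un_disjoint finite_Un)
    have cBA: "Suc (card (B - A)) = card P"
      using card_Diff_subset_Int[of B A] card_member[OF B] cP cQ finA
      by (simp add: Int_commute card_mono)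
        (metis Suc_diff_le add_diff_cancel_right' card_member[OF B] card_mono diff_Suc_Suc finB inf_le2)
    have cU: "card (A \<union> B) < card V"
      using card_Un_Int[OF finA finB] card_member[OF A] card_member[OF B] card_V cQ by linarith
    have UV: "A \<union> B \<subseteq> V" using A B subset_V by blast
    then obtain r where r: "r \<in> V" "r \<notin> A \<union> B" using cU by (metis nat_neq_iff subsetI subset_antisym)
    \<comment> \<open>The left side is exactly \<open>2 * k\<close>, as \<open>card Q\<close> is one
      less than \<open>card (A \<inter> B)\<close>.\<close>
    have "card (insert r (A \<union> B)) + card Q \<le> card V"
      using r card_Un_Int[OF finA finB] card_member[OF A] card_member[OF B] card_V cQ finA finB by simp
    then have "card Q \<le> card (V - insert r (A \<union> B))"
      using r UV finA finB by (subst card_Diff_subset) auto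
    then obtain T where T: "T \<subseteq> V - insert r (A \<union> B)" "card T = card Q"
      by (rule obtain_subset_with_card_n)
    have "Q \<union> insert r (B - A) \<in> F \<or> P \<union> T \<in> F"
    proof (rule exchange)
      show "card (insert r (B - A)) = card P" using r cBA finB by simp
    qed (use PQ Q A T r UV in auto)
    moreover have "Q \<union> insert r (B - A) \<notin> F"
    proof
      assume "Q \<union> insert r (B - A) \<in> F"
      from min[OF this] have "card (A \<inter> B) \<le> card (A \<inter> (Q \<union> insert r (B - A)))" .
      also have "A \<inter> (Q \<union> insert r (B - A)) = Q" using r by (auto simp: Q_def)
      finally show False using cQ by simp
    qed
    moreover have "B \<inter> (P \<union> T) = {q}" using T q by (auto simp: P_def Q_def)
    ultimately show thesis using B that by blast
  qed (use A B that in blast)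
qed

end

locale extremal_intersecting_strict = extremal_intersecting +
  assumes card_V_strict: "2 * k < card V"
begin

text \<open>Induction on \<open>card (S \<inter> X)\<close>, starting from \<open>S = Y\<close>. In
  the step, \<open>S'\<close> trades a point of \<open>X\<close> for one of \<open>Y\<close>, so
  \<open>insert x S'\<close> is already a member. Exchanging in \<open>insert x X\<close> yields
  \<open>insert x S\<close> or a set \<open>P \<union> T\<close> disjoint from
  \<open>insert x S'\<close>, which is impossible.\<close>

lemma pointed:
  assumes X: "insert x X \<in> F" "x \<notin> X" and Y: "insert x Y \<in> F" "x \<notin> Y" and XY: "X \<inter> Y = {}"
  shows "S \<subseteq> X \<union> Y \<Longrightarrow> card S = k - 1 \<Longrightarrow> insert x S \<in> F"
proof (induction "card (S \<inter> X)" arbitrary: S)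
  case (0 S)
  have fin: "finite X" "finite Y" using X Y subset_V finite_subset_V by blast+
  then have "S \<subseteq> Y" using 0 by (metis card_0_eq disjoint_iff finite_Int Un_iff subset_iff)
  moreover have "card Y = k - 1" using card_member[OF Y(1)] Y fin by simp
  ultimately have "S = Y" using 0 fin by (metis card_subset_eq)
  then show ?case using Y by simp
next
  case (Suc m S)
  have fin: "finite X" "finite Y" using X Y subset_V finite_subset_V by blast+
  have finS: "finite S" using Suc.prems fin finite_subset by blast
  have XV: "insert x X \<subseteq> V" "insert x Y \<subseteq> V" using X Y subset_V by auto
  have cX: "Suc (card X) = k" "Suc (card Y) = k"
    using card_member[OF Y(1)] card_member[OF X(1)] X Y fin by auto
  have cS: "card (S \<inter> X) + card (S \<inter> Y) = k - 1"
  proof -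
    have "S = (S \<inter> X) \<union> (S \<inter> Y)" using Suc.prems by blast
    then show ?thesis
      using card_Un_disjoint[of "S \<inter> X" "S \<inter> Y"] XY finS Suc.prems(2) by fastforce
  qed
  show ?case
  proof (cases "X \<subseteq> S")
    case True
    then have "S = X" using Suc.prems cX finS by (metis card_subset_eq diff_Suc_1)
    then show ?thesis using X by simp
  next
    case False
    obtain a where a: "a \<in> S \<inter> X" using Suc.hyps(2) by (metis card.empty ex_in_conv nat.distinct(1))
    have "card (S \<inter> Y) < card Y" using cS cX Suc.hyps(2) by linarith
    then obtain b where b: "b \<in> Y - S" by (metis Diff_iff Int_absorb1 nat_neq_iff subsetI)
    define S' where "S' = insert b (S - {a})"
    have S'X: "S' \<inter> X = S \<inter> X - {a}" and S'Y: "S' \<inter> Y = insert b (S \<inter> Y)"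
      using a b XY by (auto simp: S'_def)
    have S': "insert x S' \<in> F"
    proof (rule Suc.hyps(1))
      show "m = card (S' \<inter> X)" using Suc.hyps(2) a finS by (simp add: S'X)
      show "S' \<subseteq> X \<union> Y" using Suc.prems b by (auto simp: S'_def)
      have "card S' = Suc (card (S - {a}))"
        unfolding S'_def using b finS by (intro card_insert_disjoint) auto
      then show "card S' = k - 1" using Suc.prems(2) card_Suc_Diff1[OF finS, of a] a by simp
    qed
    define P where "P = X - S"
    define Q where "Q = insert x (X \<inter> S)"
    define R where "R = S \<inter> Y"
    define W where "W = insert x X \<union> insert b (S \<inter> Y)"
    have PQ: "P \<union> Q = insert x X" "P \<inter> Q = {}" using X by (auto simp: P_def Q_def)
    have cQ: "card Q = Suc (card (S \<inter> X))" using X finS by (simp add: Q_def Int_commute)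
    have "card P = card X - card (X \<inter> S)"
      unfolding P_def using card_Diff_subset_Int[of X S] finS by simp
    then have cR: "card R = card P" using cS cX by (simp add: R_def Int_commute)
    have "card W \<le> k + Suc (card (S \<inter> Y))"
      unfolding W_def using card_Un_le[of "insert x X" "insert b (S \<inter> Y)"] b finS card_member[OF X(1)] by simp
    \<comment> \<open>The bounds add up to \<open>2 * k + 1\<close>, so the strict inequality
      \<open>2 * k < card V\<close> is what leaves room for \<open>T\<close>.\<close>
    then have "card Q + card W \<le> card V" using cQ cS k_pos card_V_strict by linarith
    moreover have "W \<subseteq> V" "finite W" using XV b fin finS by (auto simp: W_def)
    ultimately have "card Q \<le> card (V - W)" by (simp add: card_Diff_subset)
    then obtain T where T: "T \<subseteq> V - W" "card T = card Q" by (rule obtain_subset_with_card_n)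
    have "Q \<union> R \<in> F \<or> P \<union> T \<in> F"
    proof (rule exchange)
      show "P \<noteq> {}" using False by (auto simp: P_def)
    qed (use PQ X XY T cR XV Y in \<open>auto simp: Q_def R_def W_def\<close>)
    moreover have "P \<union> T \<notin> F"
    proof
      assume "P \<union> T \<in> F"
      moreover have "(P \<union> T) \<inter> insert x S' = {}"
        using T X Suc.prems b XY by (auto simp: P_def W_def S'_def)
      ultimately show False using meet S' by blast
    qed
    moreover have "Q \<union> R = insert x S" using Suc.prems by (auto simp: Q_def R_def)
    ultimately show ?thesis by simp
  qed
qed

text \<open>If \<open>W - B\<close> had \<open>m\<close> points, some member
  \<open>D \<union> C\<close> would miss \<open>B\<close>. So \<open>B\<close> contains at least
  \<open>card W - m + 1 = k\<close> points of \<open>W\<close>, which is all of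
  \<open>B\<close>.\<close>

lemma subset_if_all_subsets_members:
  assumes W: "W \<subseteq> V" and all: "\<And>C. C \<subseteq> W \<Longrightarrow> card C = m \<Longrightarrow> D \<union> C \<in> F"
    and B: "B \<in> F" "B \<inter> D = {}" and c: "card W + 1 = m + k"
  shows "B \<subseteq> W"
proof -
  have fin: "finite W" "finite B" using W B subset_V finite_subset_V by blast+
  have "card (W - B) < m"
  proof (rule ccontr)
    assume "\<not> card (W - B) < m"
    then obtain C where "C \<subseteq> W - B" "card C = m"
      by (metis not_less obtain_subset_with_card_n)
    then show False using all[of C] meet[OF B(1), of "D \<union> C"] B(2) by blast
  qed
  then have "k \<le> card (W \<inter> B)" using card_Diff_subset_Int[of W B] fin c by (simp add: card_mono)
  then have "W \<inter> B = B" using card_member[OF B(1)] fin by (metis card_seteq inf_le2)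
  then show ?thesis by blast
qed

text \<open>A member avoiding \<open>x\<close> would force \<open>F\<close> to consist of \<open>k\<close>-subsets of a single set with
  \<open>2 k - 1\<close> elements, which are too few because \<open>2 k < card V\<close>.\<close>

lemma star: "\<exists>x\<in>V. F = {A. A \<subseteq> V \<and> card A = k \<and> x \<in> A}"
proof -
  obtain A1 A2 x where A: "A1 \<in> F" "A2 \<in> F" "A1 \<inter> A2 = {x}" by (rule meet_in_one_point)
  define X where "X = A1 - {x}"
  define Y where "Y = A2 - {x}"
  have X: "insert x X \<in> F" "x \<notin> X" and Y: "insert x Y \<in> F" "x \<notin> Y" and XY: "X \<inter> Y = {}"
  proof -
    have "x \<in> A1" "x \<in> A2" using A(3) by blast+
    then show "insert x X \<in> F" "insert x Y \<in> F" using A(1,2) by (simp_all add: X_def Y_def insert_absorb)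
  qed (use A(3) in \<open>auto simp: X_def Y_def\<close>)
  have XV: "insert x X \<subseteq> V" "insert x Y \<subseteq> V" using X Y subset_V by auto
  have fin: "finite X" "finite Y" using XV finite_subset_V by blast+
  have cX: "Suc (card X) = k" "Suc (card Y) = k"
    using card_member[OF Y(1)] card_member[OF X(1)] X Y fin by auto
  have cXY: "card (X \<union> Y) = 2 * (k - 1)"
    using cX XY fin by (subst card_Un_disjoint) auto
  have pt: "insert x S \<in> F" if "S \<subseteq> X \<union> Y" "card S = k - 1" for S
    using pointed[OF X Y XY that] .
  have all_x: "x \<in> B" if B: "B \<in> F" for B
  proof (rule ccontr)
    assume xB: "x \<notin> B"
    have BXY: "B \<subseteq> X \<union> Y"
    proof (rule subset_if_all_subsets_members[OF _ _ B, of _ "k - 1" "{x}"])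
      show "card (X \<union> Y) + 1 = k - 1 + k" using cXY k_pos by simp
    qed (use XV xB pt in auto)
    have finB: "finite B" using BXY fin finite_subset by blast
    have cB: "card B = k" using card_member[OF B] .
    \<comment> \<open>A \<open>k\<close>-set inside a set with \<open>2 * (k - 1)\<close> points
      forces \<open>2 \<le> k\<close>.\<close>
    have k2: "2 \<le> k" using card_mono[OF _ BXY] cB cXY k_pos fin by simp
    define W where "W = insert x (X \<union> Y)"
    have cW: "card W = 2 * k - 1" using cXY X Y fin k_pos by (simp add: W_def)
    have finW: "finite W" and WV: "W \<subseteq> V" using fin XV by (auto simp: W_def)
    have BW: "B \<subseteq> W" using BXY by (auto simp: W_def)
    have cWB: "card (W - B) = k - 1" using cW cB BW finB by (simp add: card_Diff_subset)
    have all_W: "C \<in> F" if C: "C \<subseteq> W" "card C = k" for C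
    proof -
      have "\<not> C \<subseteq> W - B"
        using card_mono[of "W - B" C] finW cWB C k_pos by auto
      then obtain b where b: "b \<in> C" "b \<in> B" using C by blast
      have "insert b (C - {b}) \<in> F"
      \<comment> \<open>\<open>pointed\<close> is applied a second time, centred at
        \<open>b\<close>: the members \<open>B\<close> and \<open>insert b (W - B)\<close> meet only
        in \<open>b\<close> and together cover \<open>W\<close>.\<close>
      proof (rule pointed[of b "B - {b}" "W - B"])
        show "insert b (B - {b}) \<in> F" using B b by (simp add: insert_absorb)
        define S where "S = insert b (X \<union> Y - B)"
        have "card (X \<union> Y - B) = k - 2" using cXY cB BXY finB by (simp add: card_Diff_subset)
        then have "card S = k - 1" using b k2 fin by (simp add: S_def)
        moreover have "S \<subseteq> X \<union> Y" using b BXY by (auto simp: S_def)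
        ultimately have "insert x S \<in> F" by (rule pt[rotated])
        also have "insert x S = insert b (W - B)" using xB by (auto simp: S_def W_def)
        finally show "insert b (W - B) \<in> F" .
        show "card (C - {b}) = k - 1" using b C by simp
      qed (use b C BW in auto)
      then show ?thesis using b by (simp add: insert_absorb)
    qed
    have "G \<subseteq> W" if "G \<in> F" for G
      by (rule subset_if_all_subsets_members[OF WV _ that, of k "{}"]) (use all_W cW k_pos in auto)
    then have "F \<subseteq> {C. C \<subseteq> W \<and> card C = k}" using card_member by blast
    then have "card F \<le> card {C. C \<subseteq> W \<and> card C = k}" by (rule card_mono[rotated]) (simp add: finW)
    also have "\<dots> = (2 * k - 1) choose k" using n_subsets[OF finW] cW by simp
    also have "\<dots> = (2 * k - 1) choose (k - 1)"
      using binomial_symmetric[of k "2 * k - 1"] k_pos by (simp add: mult_2)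
    also have "\<dots> < Suc (2 * k - 1) choose (k - 1)"
    proof -
      \<comment> \<open>Pascal's rule adds \<open>(2 * k - 1) choose l\<close>, which is positive;
        \<open>2 \<le> k\<close> makes \<open>l\<close> exist.\<close>
      obtain l where l: "k - 1 = Suc l" using k2 by (cases "k - 1") auto
      show ?thesis unfolding l binomial_Suc_Suc using l by (simp add: zero_less_binomial_iff)
    qed
    also have "\<dots> \<le> (card V - 1) choose (k - 1)"
      using card_V_strict k_pos by (intro binomial_right_mono) auto
    finally show False using card_F by simp
  qed
  have fs: "finite {A. A \<subseteq> V \<and> card A = k \<and> x \<in> A}" using finite_V by simp
  moreover have "F \<subseteq> {A. A \<subseteq> V \<and> card A = k \<and> x \<in> A}" using subset_V card_member all_x by blast
  moreover have "card {A. A \<subseteq> V \<and> card A = k \<and> x \<in> A} \<le> card F"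
    using card_star[OF finite_V, of x "k - 1"] XV k_pos card_F by simp
  ultimately show ?thesis using XV by (metis card_seteq insert_subset)
qed

end

subsection \<open>Pairs of levels\<close>

text \<open>Let \<open>N\<close> be the \<open>j\<close>-sets outside \<open>G\<close>. All
  \<open>j\<close>-sets disjoint from a member of \<open>F\<close> lie in \<open>N\<close>, so in
  the disjointness graph between \<open>F\<close> and \<open>N\<close> each degree on the side of
  \<open>F\<close> is at least each degree on the side of \<open>N\<close>. Hence
  \<open>card F \<le> card N\<close>.\<close>

lemma cross_intersecting_levels:
  fixes V :: "'a set"
  assumes V: "finite V" and ij: "i < j" "i + j \<le> card V"
    and F: "F \<subseteq> {A. A \<subseteq> V \<and> card A = i}" and G: "G \<subseteq> {B. B \<subseteq> V \<and> card B = j}"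
    and cross: "\<And>A B. A \<in> F \<Longrightarrow> B \<in> G \<Longrightarrow> A \<inter> B \<noteq> {}"
  shows "card F + card G \<le> card V choose j"
    and "i + j < card V \<Longrightarrow> card F + card G = card V choose j \<Longrightarrow> F = {}"
proof -
  define N where "N = {B. B \<subseteq> V \<and> card B = j} - G"
  \<comment> \<open>By symmetry of binomial coefficients both degrees become choices of
    \<open>m\<close> points, so they compare by monotonicity in the upper argument.\<close>
  define m where "m = card V - i - j"
  have finF: "finite F" and finG: "finite G" and finN: "finite N"
    using V finite_subset[OF F] finite_subset[OF G] by (auto simp: N_def)
  have cN: "card N + card G = card V choose j"
  proof -
    have "card N = (card V choose j) - card G"
      unfolding N_def using card_Diff_subset[OF finG G] n_subsets[OF V] by simp
    moreover have "card G \<le> card V choose j"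
      using card_mono[OF _ G] n_subsets[OF V, of j] V by simp
    ultimately show ?thesis by simp
  qed
  have up: "card {B \<in> N. A \<inter> B = {}} = (card V - i) choose m" if A: "A \<in> F" for A
  proof -
    have "{B \<in> N. A \<inter> B = {}} = {B. B \<subseteq> V - A \<and> card B = j}"
      using cross[OF A] by (auto simp: N_def)
    moreover have "A \<subseteq> V" "card A = i" using A F by auto
    moreover have "finite A" using \<open>A \<subseteq> V\<close> V finite_subset by blast
    ultimately show ?thesis
      using n_subsets[of "V - A" j] V ij binomial_symmetric[of j "card V - i"]
      by (simp add: card_Diff_subset m_def)
  qed
  have down: "card {A \<in> F. A \<inter> B = {}} \<le> (card V - j) choose m" if B: "B \<in> N" for B
  proof -
    have BV: "B \<subseteq> V" "card B = j" using B by (auto simp: N_def)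
    then have "finite B" using V finite_subset by blast
    have "card {A \<in> F. A \<inter> B = {}} \<le> card {A. A \<subseteq> V - B \<and> card A = i}"
      using F V by (intro card_mono) auto
    also have "\<dots> = (card V - j) choose i"
      using n_subsets[of "V - B" i] V BV \<open>finite B\<close> by (simp add: card_Diff_subset)
    also have "\<dots> = (card V - j) choose m"
      using ij binomial_symmetric[of i "card V - j"] by (simp add: m_def add.commute)
    finally show ?thesis .
  qed
  have "card F * ((card V - i) choose m) = (\<Sum>A\<in>F. card {B \<in> N. A \<inter> B = {}})"
    using up by simp
  also have "\<dots> = (\<Sum>B\<in>N. card {A \<in> F. A \<inter> B = {}})"
    using sum.swap_restrict[OF finF finN, of "\<lambda>_ _. 1::nat" "\<lambda>A B. A \<inter> B = {}"] by simp
  also have "\<dots> \<le> card N * ((card V - j) choose m)"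
    using sum_bounded_above[of N "\<lambda>B. card {A \<in> F. A \<inter> B = {}}"] down by simp
  finally have count: "card F * ((card V - i) choose m) \<le> card N * ((card V - j) choose m)" .
  have mono: "(card V - j) choose m \<le> (card V - i) choose m"
    using ij by (intro binomial_right_mono) simp
  have pos: "0 < (card V - j) choose m" by (simp add: zero_less_binomial_iff m_def)
  have "card F * ((card V - j) choose m) \<le> card N * ((card V - j) choose m)"
    using count mono by (meson le_trans mult_le_mono2)
  then have FN: "card F \<le> card N" using pos by simp
  then show "card F + card G \<le> card V choose j" using cN by simp
  show "F = {}" if strict: "i + j < card V" "card F + card G = card V choose j"
  proof -
    \<comment> \<open>With \<open>m\<close> positive the degrees differ strictly, so
      \<open>card N = card F\<close> is possible only if both are \<open>0\<close>.\<close>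
    obtain l where l: "m = Suc l" using strict(1) by (cases m) (auto simp: m_def)
    have "(card V - j) choose m < Suc (card V - j) choose m"
      using l by (simp add: zero_less_binomial_iff m_def)
    also have "\<dots> \<le> (card V - i) choose m" using ij by (intro binomial_right_mono) simp
    finally have "(card V - j) choose m < (card V - i) choose m" .
    moreover have "card N = card F" using strict cN by simp
    ultimately have "card F = 0" using count by simp
    then show ?thesis using finF by simp
  qed
qed

lemma card_by_levels:
  assumes "finite V"
  shows "card {A. A \<subseteq> V \<and> a \<le> card A \<and> card A \<le> u \<and> P A}
    = (\<Sum>i=a..u. card {A. A \<subseteq> V \<and> card A = i \<and> P A})"
proof -
  have "{A. A \<subseteq> V \<and> a \<le> card A \<and> card A \<le> u \<and> P A} = (\<Union>i\<in>{a..u}. {A. A \<subseteq> V \<and> card A = i \<and> P A})"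
    by auto
  also have "card \<dots> = (\<Sum>i=a..u. card {A. A \<subseteq> V \<and> card A = i \<and> P A})"
    by (rule card_UN_disjoint) (use assms in auto)
  finally show ?thesis .
qed

section \<open>Level sizes of a conditionally intersecting family\<close>

locale conditionally_intersecting =
  fixes V :: "'a set" and F :: "'a set set" and s u :: nat
  assumes finite_V: "finite V" and s_le: "s \<le> card V"
    and F_subset: "\<And>A. A \<in> F \<Longrightarrow> A \<subseteq> V \<and> card A \<le> u"
    and cond: "cond_intersecting s F"
begin

definition level :: "nat \<Rightarrow> 'a set set" where
  "level i = {A \<in> F. card A = i}"

lemma level_subset: "level i \<subseteq> {A. A \<subseteq> V \<and> card A = i}"
  using F_subset by (auto simp: level_def)

lemma level_0: "level 0 = {}"
proof -
  have "{} \<notin> F" using cond by (fastforce simp: cond_intersecting_def)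
  then show ?thesis using F_subset finite_V finite_subset by (fastforce simp: level_def)
qed

lemma level_meet:
  assumes "A \<in> level i" "B \<in> level j" "i + j \<le> s"
  shows "A \<inter> B \<noteq> {}"
  using assms cond card_Un_le[of A B] unfolding cond_intersecting_def level_def by fastforce

lemma card_level_le: "card (level i) \<le> card V choose i"
  using card_mono[OF _ level_subset, of i] n_subsets[OF finite_V, of i] finite_V by simp

lemma level_full:
  assumes "card (level i) = card V choose i"
  shows "level i = {A. A \<subseteq> V \<and> card A = i}"
  using card_subset_eq[OF _ level_subset, of i] n_subsets[OF finite_V, of i] assms finite_V by simp

lemma card_F: "card F = (\<Sum>i=1..u. card (level i))"
proof -
  have "A \<in> F \<Longrightarrow> 1 \<le> card A" for A
    using level_0 by (cases "card A") (auto simp: level_def)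
  then have "F = {A. A \<subseteq> V \<and> 1 \<le> card A \<and> card A \<le> u \<and> A \<in> F}"
    using F_subset by blast
  also have "card \<dots> = (\<Sum>i=1..u. card {A. A \<subseteq> V \<and> card A = i \<and> A \<in> F})"
    by (rule card_by_levels[OF finite_V])
  also have "\<dots> = (\<Sum>i=1..u. card (level i))"
    using F_subset by (intro sum.cong arg_cong[of _ _ card]) (auto simp: level_def)
  finally show ?thesis .
qed

text \<open>For \<open>j \<ge> s\<close> the truncated index \<open>s - j\<close> is \<open>0\<close> and that level is empty.\<close>

lemma paired_levels:
  assumes "s < 2 * j"
  shows "card (level j) + card (level (s - j)) \<le> card V choose j"
    and "s < card V \<Longrightarrow> card (level j) + card (level (s - j)) = card V choose j \<Longrightarrow>
      level (s - j) = {} \<and> level j = {A. A \<subseteq> V \<and> card A = j}"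
proof -
  have *: "card (level j) + card (level (s - j)) \<le> card V choose j \<and>
      (s < card V \<longrightarrow> card (level j) + card (level (s - j)) = card V choose j \<longrightarrow> level (s - j) = {})"
  proof (cases "j < s")
    case True
    have "s - j < j" "s - j + j \<le> card V" using True assms s_le by auto
    note c = cross_intersecting_levels[OF finite_V this level_subset level_subset]
    have m: "A \<inter> B \<noteq> {}" if "A \<in> level (s - j)" "B \<in> level j" for A B
      using level_meet[OF that] True by simp
    show ?thesis using c[OF m] True by (simp add: add.commute)
  qed (simp add: level_0 card_level_le)
  then show "card (level j) + card (level (s - j)) \<le> card V choose j" by blast
  show "level (s - j) = {} \<and> level j = {A. A \<subseteq> V \<and> card A = j}"
    if "s < card V" "card (level j) + card (level (s - j)) = card V choose j"
    using * that level_full[of j] by simp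
qed

text \<open>Substituting \<open>i = s - j\<close> lists each low level next to its partner. The
  indices from \<open>s\<close> to \<open>u\<close> add only the empty level \<open>0\<close> and
  let both sums run up to \<open>u\<close>.\<close>

lemma sum_low_levels:
  assumes "h < s" "s \<le> u + 1"
  shows "(\<Sum>i=1..h. card (level i)) = (\<Sum>j=s-h..u. card (level (s - j)))"
proof -
  have "(\<Sum>i=1..h. card (level i)) = (\<Sum>j=s-h..s-1. card (level (s - j)))"
    by (rule sum.reindex_bij_witness[of _ "\<lambda>j. s - j" "\<lambda>i. s - i"]) (use assms in auto)
  also have "\<dots> = (\<Sum>j=s-h..u. card (level (s - j)))"
    by (rule sum.mono_neutral_left) (use assms level_0 in auto)
  finally show ?thesis .
qed

lemma uniform_intersecting_level:
  assumes "0 < k" "2 * k \<le> s"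
  shows "uniform_intersecting V (level k) k"
proof
  show "A \<inter> B \<noteq> {}" if "A \<in> level k" "B \<in> level k" for A B
    using level_meet[OF that] assms by simp
qed (use finite_V assms s_le level_subset in auto)

text \<open>In the next three lemmas \<open>a = k + 1\<close> if \<open>s = 2 k\<close>, and \<open>a = k\<close> if \<open>s = 2 k - 1\<close>.\<close>

lemma card_F_paired:
  assumes "0 < k" "k \<le> a" "a \<le> k + 1" "a + k = s + 1" "s \<le> u + 1"
  shows "card F = (if k < a then card (level k) else 0)
    + (\<Sum>j=a..u. card (level j) + card (level (s - j)))"
proof -
  \<comment> \<open>For even \<open>s\<close> the level \<open>k\<close> is its own partner and
    stays unpaired; for odd \<open>s\<close> there is no such level.\<close>
  have "card F = (\<Sum>i\<in>{1..k-1} \<union> (if k < a then {k} else {}) \<union> {a..u}. card (level i))"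
    unfolding card_F by (rule sum.cong) (use assms in auto)
  also have "\<dots> = (\<Sum>i=1..k-1. card (level i)) + (if k < a then card (level k) else 0)
      + (\<Sum>i=a..u. card (level i))"
    using assms by (subst sum.union_disjoint; (subst sum.union_disjoint)?) auto
  also have "(\<Sum>i=1..k-1. card (level i)) = (\<Sum>j=s-(k-1)..u. card (level (s - j)))"
    by (rule sum_low_levels) (use assms in auto)
  also have "s - (k - 1) = a" using assms by simp
  finally show ?thesis by (simp add: sum.distrib)
qed

lemma paired_sum_le:
  assumes "k \<le> a" "a + k = s + 1"
  shows "(\<Sum>j=a..u. card (level j) + card (level (s - j))) \<le> (\<Sum>j=a..u. card V choose j)"
  using assms by (intro sum_mono paired_levels(1)) auto

lemma F_eq_if_paired_sum_eq:
  assumes "s < card V" "k \<le> a" "a \<le> k + 1" "a + k = s + 1" "s \<le> u + 1"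
    and eq: "(\<Sum>j=a..u. card (level j) + card (level (s - j))) = (\<Sum>j=a..u. card V choose j)"
  shows "A \<in> F \<longleftrightarrow> (k < a \<and> A \<in> level k) \<or> (A \<subseteq> V \<and> a \<le> card A \<and> card A \<le> u)"
proof -
  have s2: "s < 2 * j" if "j \<in> {a..u}" for j using that assms by auto
  have levels: "level (s - j) = {} \<and> level j = {A. A \<subseteq> V \<and> card A = j}" if "j \<in> {a..u}" for j
    \<comment> \<open>Each pair is bounded separately, so equality of the sums forces equality in
      every pair.\<close>
    using paired_levels(2)[OF s2[OF that] assms(1)]
      sum_mono_inv[OF eq paired_levels(1)[OF s2] that] by blast
  have low: "level i = {}" if "i < k" for i
  proof (cases "i = 0")
    case False
    \<comment> \<open>Every level \<open>i\<close> with \<open>0 < i < k\<close> is the lower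
      partner of level \<open>s - i\<close>.\<close>
    have "s - (s - i) = i" "s - i \<in> {a..u}" using assms(2-5) that False by auto
    then show ?thesis using levels[of "s - i"] by simp
  qed (simp add: level_0)
  consider "card A < k" | "card A = k" "k < a" | "a \<le> card A" using assms by linarith
  then show ?thesis
  proof cases
    case 1
    then have "A \<notin> level (card A)" using low by simp
    then show ?thesis using 1 assms by (auto simp: level_def)
  next
    case 2
    then show ?thesis by (auto simp: level_def)
  next
    case 3
    then show ?thesis using levels[of "card A"] F_subset by (auto simp: level_def)
  qed
qed

text \<open>The Erdos-Ko-Rado bound handles the unpaired level \<open>k\<close>, and
  \<open>paired_levels\<close> handles the rest.\<close>

lemma even_card_le:
  assumes "0 < k" "s = 2 * k" "s \<le> u + 1"
  shows "card F \<le> ((card V - 1) choose (k - 1)) + (\<Sum>i=k+1..u. card V choose i)"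
proof -
  interpret uniform_intersecting V "level k" k by (rule uniform_intersecting_level) (use assms in auto)
  show ?thesis
    using card_F_paired[of k "k + 1"] paired_sum_le[of k "k + 1"] card_le assms by simp
qed

text \<open>Both bounds must be attained. Since \<open>2 * k = s < card V\<close>, the level
  \<open>k\<close> is a star, while the pairs determine all other levels.\<close>

lemma even_extremal:
  assumes "0 < k" "s = 2 * k" "s \<le> u + 1" "s < card V"
    and "card F = ((card V - 1) choose (k - 1)) + (\<Sum>i=k+1..u. card V choose i)"
  shows "\<exists>x\<in>V. F = {A. A \<subseteq> V \<and> (k \<le> card A \<and> card A \<le> u) \<and> (card A = k \<longrightarrow> x \<in> A)}"
proof -
  interpret uniform_intersecting V "level k" k by (rule uniform_intersecting_level) (use assms in auto)
  have "card (level k) = (card V - 1) choose (k - 1)"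
    and eq: "(\<Sum>j=k+1..u. card (level j) + card (level (s - j))) = (\<Sum>j=k+1..u. card V choose j)"
    using card_F_paired[of k "k + 1"] paired_sum_le[of k "k + 1"] card_le assms by simp_all
  then interpret extremal_intersecting_strict V "level k" k
    by unfold_locales (use assms in auto)
  obtain x where x: "x \<in> V" "level k = {A. A \<subseteq> V \<and> card A = k \<and> x \<in> A}" using star by blast
  have "k \<le> u" using assms by simp
  then have "F = {A. A \<subseteq> V \<and> (k \<le> card A \<and> card A \<le> u) \<and> (card A = k \<longrightarrow> x \<in> A)}"
    using F_eq_if_paired_sum_eq[OF assms(4) _ _ _ assms(3) eq, of k] assms(2) x(2) by auto
  then show ?thesis using x(1) by blast
qed

lemma odd_card_le:
  assumes "0 < k" "s = 2 * k - 1" "s \<le> u + 1"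
  shows "card F \<le> (\<Sum>i=k..u. card V choose i)"
  using card_F_paired[of k k] paired_sum_le[of k k] assms by simp

lemma odd_extremal:
  assumes "0 < k" "s = 2 * k - 1" "s \<le> u + 1" "s < card V"
    and "card F = (\<Sum>i=k..u. card V choose i)"
  shows "F = {A. A \<subseteq> V \<and> k \<le> card A \<and> card A \<le> u}"
  using card_F_paired[of k k] F_eq_if_paired_sum_eq[OF assms(4), of k k] assms by auto

section \<open>Small sets: every level is intersecting\<close>

lemma low_level_le:
  assumes "u \<le> s div 2" "i \<in> {1..u}"
  shows "card (level i) \<le> (card V - 1) choose (i - 1)"
proof -
  interpret uniform_intersecting V "level i" i by (rule uniform_intersecting_level) (use assms in auto)
  show ?thesis by (rule card_le)
qed

lemma low_card_le:
  assumes "u \<le> s div 2"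
  shows "card F \<le> (\<Sum>r=1..u. (card V - 1) choose (r - 1))"
  unfolding card_F by (rule sum_mono) (rule low_level_le[OF assms])

text \<open>Equality forces the level of singletons to be nonempty.\<close>

lemma low_extremal:
  assumes "0 < u" "u \<le> s div 2" and eq: "card F = (\<Sum>r=1..u. (card V - 1) choose (r - 1))"
  shows "\<exists>x\<in>V. F = {A. A \<subseteq> V \<and> (1 \<le> card A \<and> card A \<le> u) \<and> x \<in> A}"
proof -
  \<comment> \<open>Equality of the sums is read off at \<open>r = 1\<close>, where the bound is
    \<open>1\<close>.\<close>
  have "card (level 1) = (card V - 1) choose (1 - 1)"
    by (rule sum_mono_inv[OF eq[unfolded card_F] low_level_le[OF assms(2)]]) (use assms in auto)
  then have "card (level 1) = 1" by simp
  then obtain S where "S \<in> level 1" by (metis card_1_singletonE insertI1)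
  then obtain x where x: "{x} \<in> F" by (auto simp: level_def card_1_singleton_iff)
  have xV: "x \<in> V" using F_subset[OF x] by simp
  let ?S = "{A. A \<subseteq> V \<and> (1 \<le> card A \<and> card A \<le> u) \<and> x \<in> A}"
  have "A \<in> ?S" if A: "A \<in> F" for A
  proof -
    have "finite A" using F_subset[OF A] finite_V finite_subset by blast
    \<comment> \<open>\<open>level_meet\<close> applies because
      \<open>card A + 1 \<le> 2 * u \<le> s\<close>.\<close>
    have "A \<inter> {x} \<noteq> {}"
      by (rule level_meet[of _ "card A" _ 1]) (use A x F_subset[OF A] assms in \<open>auto simp: level_def\<close>)
    then have "x \<in> A" by simp
    moreover from this have "1 \<le> card A" using \<open>finite A\<close> by (simp add: Suc_le_eq card_gt_0_iff) blast
    ultimately show ?thesis using F_subset[OF A] by blast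
  qed
  then have "F \<subseteq> ?S" by blast
  moreover have "card ?S = card F"
  proof -
    have "card ?S = (\<Sum>i=1..u. card {A. A \<subseteq> V \<and> card A = i \<and> x \<in> A})"
      using card_by_levels[OF finite_V, of 1 u "\<lambda>A. x \<in> A"] by (simp add: conj_assoc)
    also have "\<dots> = card F"
      unfolding eq
    proof (rule sum.cong[OF refl])
      fix i assume "i \<in> {1..u}"
      then show "card {A. A \<subseteq> V \<and> card A = i \<and> x \<in> A} = (card V - 1) choose (i - 1)"
        using card_star[OF finite_V xV, of "i - 1"] by simp
    qed
    finally show ?thesis .
  qed
  ultimately have "F = ?S" using finite_V by (intro card_subset_eq) auto
  then show ?thesis using xV by blast
qed

end

subsection \<open>Families up to isomorphism\<close>

text \<open>The transposition preserves cardinalities and interchanges \<open>x\<close> and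
  \<open>y\<close>. The predicates \<open>Q\<close> and \<open>R\<close> allow a star on one level
  only, as in (i), or on all levels, as in (iii).\<close>

lemma transpose_star_image:
  assumes "x \<in> V" and "y \<in> V"
  shows "{A. A \<subseteq> V \<and> Q (card A) \<and> (R (card A) \<longrightarrow> x \<in> A)} =
    (\<lambda>A. transpose y x ` A) ` {A. A \<subseteq> V \<and> Q (card A) \<and> (R (card A) \<longrightarrow> y \<in> A)}"
    (is "?S x = (\<lambda>A. ?p ` A) ` ?S y")
proof -
  have p: "?p permutes V" using assms by (intro permutes_swap_id)
  have inv: "?p ` ?p ` A = A" for A by (simp add: image_image)
  have card: "card (?p ` A) = card A" for A
    using p by (intro card_image inj_on_subset[OF permutes_inj]) auto
  have sub: "?p ` A \<subseteq> V \<longleftrightarrow> A \<subseteq> V" for A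
    by (metis inv permutes_image[OF p] image_mono)
  have mem: "z \<in> ?p ` A \<longleftrightarrow> ?p z \<in> A" for z A by (metis imageE imageI transpose_involutory)
  have "(\<lambda>A. ?p ` A) ` ?S y \<subseteq> ?S x"
    unfolding image_subset_iff by (simp add: card sub mem)
  moreover have "A \<in> (\<lambda>A. ?p ` A) ` ?S y" if "A \<in> ?S x" for A
  proof (rule image_eqI)
    show "?p ` A \<in> ?S y" using that by (simp add: card sub mem)
  qed (simp add: inv)
  ultimately show ?thesis by blast
qed

lemma family_iso_star:
  assumes "x \<in> {1..n}"
  shows "family_iso n {A. A \<subseteq> {1..n} \<and> Q (card A) \<and> (R (card A) \<longrightarrow> x \<in> A)}
    {A. A \<subseteq> {1..n} \<and> Q (card A) \<and> (R (card A) \<longrightarrow> 1 \<in> A)}"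
proof -
  have one: "1 \<in> {1..n}" using assms by simp
  show ?thesis
    unfolding family_iso_def
    using transpose_star_image[OF assms one, of Q R] permutes_swap_id[OF one assms] by blast
qed

text \<open>This reduces the converse directions in (i) and (iii) to counting the standard
  family.\<close>

lemma card_family_iso: "family_iso n \<F> \<G> \<Longrightarrow> card \<F> = card \<G>"
proof -
  assume "family_iso n \<F> \<G>"
  then obtain p where "p permutes {1..n}" "\<F> = (\<lambda>X. p ` X) ` \<G>" by (auto simp: family_iso_def)
  moreover have "inj_on (\<lambda>X. p ` X) \<G>"
    using \<open>p permutes {1..n}\<close> by (intro inj_onI) (metis inj_image_eq_iff permutes_inj)
  ultimately show ?thesis by (simp add: card_image)
qed

theorem theorem25:
  fixes n s u :: nat and \<F> :: "nat set set"
  assumes "0 < n" and "0 < s" and "0 < u" and "s \<le> n"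
    and "\<F> \<subseteq> subsets_upto n u"
    and "cond_intersecting s \<F>"
  shows
    "(\<forall>k. u \<ge> s - 1 \<and> s = 2 * k \<longrightarrow>
        card \<F> \<le> ((n - 1) choose (k - 1)) + (\<Sum>i=k+1..u. n choose i) \<and>
        (s < n \<longrightarrow>
          (card \<F> = ((n - 1) choose (k - 1)) + (\<Sum>i=k+1..u. n choose i) \<longleftrightarrow>
           family_iso n \<F>
             ({F \<in> Pow {1..n}. k < card F \<and> card F \<le> u} \<union> {F \<in> ksubsets n k. 1 \<in> F}))))
     \<and>
     (\<forall>k. u \<ge> s - 1 \<and> s = 2 * k - 1 \<longrightarrow>
        card \<F> \<le> (\<Sum>i=k..u. n choose i) \<and>
        (s < n \<longrightarrow>
          (card \<F> = (\<Sum>i=k..u. n choose i) \<longleftrightarrow>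
           \<F> = {F \<in> Pow {1..n}. k \<le> card F \<and> card F \<le> u})))
     \<and>
     (u \<le> s div 2 \<longrightarrow>
        card \<F> \<le> (\<Sum>r=1..u. (n - 1) choose (r - 1)) \<and>
        (card \<F> = (\<Sum>r=1..u. (n - 1) choose (r - 1)) \<longleftrightarrow>
         family_iso n \<F> {F \<in> Pow {1..n}. 1 \<le> card F \<and> card F \<le> u \<and> 1 \<in> F}))"
proof -
  interpret conditionally_intersecting "{1..n}" \<F> s u
    using assms by unfold_locales (auto simp: subsets_upto_def)
  have one: "1 \<in> {1..n}" using assms(1) by simp
  have full: "card {A. A \<subseteq> {1..n} \<and> a \<le> card A \<and> card A \<le> u} = (\<Sum>i=a..u. n choose i)" for a
    using card_by_levels[of "{1..n}" a u "\<lambda>_. True"] n_subsets[of "{1..n}"] by simp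
  have star: "card {A. A \<subseteq> {1..n} \<and> card A = k \<and> 1 \<in> A} = (n - 1) choose (k - 1)" if "0 < k" for k
    using card_star[OF finite_V one, of "k - 1"] that by simp
  show ?thesis
  proof (intro conjI allI impI; (elim conjE)?)
    fix k assume u: "s - 1 \<le> u" and s: "s = 2 * k"
    have k: "0 < k" "s \<le> u + 1" using u s assms by auto
    show "card \<F> \<le> ((n - 1) choose (k - 1)) + (\<Sum>i=k+1..u. n choose i)"
      using even_card_le[OF k(1) s k(2)] by simp
    let ?G = "{F \<in> Pow {1..n}. k < card F \<and> card F \<le> u} \<union> {F \<in> ksubsets n k. 1 \<in> F}"
    assume "s < n"
    show "card \<F> = ((n - 1) choose (k - 1)) + (\<Sum>i=k+1..u. n choose i) \<longleftrightarrow> family_iso n \<F> ?G"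
    proof
      assume "card \<F> = ((n - 1) choose (k - 1)) + (\<Sum>i=k+1..u. n choose i)"
      then obtain x where x: "x \<in> {1..n}"
        "\<F> = {A. A \<subseteq> {1..n} \<and> (k \<le> card A \<and> card A \<le> u) \<and> (card A = k \<longrightarrow> x \<in> A)}"
        using even_extremal[OF k(1) s k(2)] \<open>s < n\<close> by auto
      \<comment> \<open>The bound \<open>card A \<le> u\<close> also holds on level
        \<open>k\<close>, since \<open>2 * k \<le> u + 1\<close> and \<open>0 < k\<close> give
        \<open>k \<le> u\<close>.\<close>
      have "?G = {A. A \<subseteq> {1..n} \<and> (k \<le> card A \<and> card A \<le> u) \<and> (card A = k \<longrightarrow> 1 \<in> A)}"
        using k s by (auto simp: ksubsets_def)
      then show "family_iso n \<F> ?G"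
        using family_iso_star[OF x(1), of "\<lambda>c. k \<le> c \<and> c \<le> u" "\<lambda>c. c = k"] x(2) by simp
    next
      assume "family_iso n \<F> ?G"
      then have "card \<F> = card ?G" by (rule card_family_iso)
      also have "?G = {A. A \<subseteq> {1..n} \<and> k + 1 \<le> card A \<and> card A \<le> u}
          \<union> {A. A \<subseteq> {1..n} \<and> card A = k \<and> 1 \<in> A}"
        by (auto simp: ksubsets_def)
      also have "card \<dots> = (\<Sum>i=k+1..u. n choose i) + ((n - 1) choose (k - 1))"
        using full[of "k + 1"] star[OF k(1)] by (subst card_Un_disjoint) auto
      finally show "card \<F> = ((n - 1) choose (k - 1)) + (\<Sum>i=k+1..u. n choose i)" by simp
    qed
  next
    fix k assume u: "s - 1 \<le> u" and s: "s = 2 * k - 1"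
    \<comment> \<open>With truncated subtraction \<open>k = 0\<close> would give
      \<open>s = 0\<close>, which \<open>0 < s\<close> excludes.\<close>
    have k: "0 < k" "s \<le> u + 1" using u s assms by auto
    show "card \<F> \<le> (\<Sum>i=k..u. n choose i)"
      using odd_card_le[OF k(1) s k(2)] by simp
    assume "s < n"
    then show "card \<F> = (\<Sum>i=k..u. n choose i) \<longleftrightarrow>
        \<F> = {F \<in> Pow {1..n}. k \<le> card F \<and> card F \<le> u}"
      using odd_extremal[OF k(1) s k(2)] full[of k] by auto
  next
    assume u: "u \<le> s div 2"
    show "card \<F> \<le> (\<Sum>r=1..u. (n - 1) choose (r - 1))"
      using low_card_le[OF u] by simp
    let ?G = "{F \<in> Pow {1..n}. 1 \<le> card F \<and> card F \<le> u \<and> 1 \<in> F}"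
    show "card \<F> = (\<Sum>r=1..u. (n - 1) choose (r - 1)) \<longleftrightarrow> family_iso n \<F> ?G"
    proof
      assume "card \<F> = (\<Sum>r=1..u. (n - 1) choose (r - 1))"
      then obtain x where x: "x \<in> {1..n}"
        "\<F> = {A. A \<subseteq> {1..n} \<and> (1 \<le> card A \<and> card A \<le> u) \<and> x \<in> A}"
        using low_extremal[OF assms(3) u] by auto
      then show "family_iso n \<F> ?G"
        using family_iso_star[OF x(1), of "\<lambda>c. 1 \<le> c \<and> c \<le> u" "\<lambda>_. True"] by simp
    next
      assume "family_iso n \<F> ?G"
      then have "card \<F> = card ?G" by (rule card_family_iso)
      also have "\<dots> = (\<Sum>i=1..u. card {A. A \<subseteq> {1..n} \<and> card A = i \<and> 1 \<in> A})"
        using card_by_levels[of "{1..n}" 1 u "\<lambda>A. 1 \<in> A"] by simp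
      also have "\<dots> = (\<Sum>r=1..u. (n - 1) choose (r - 1))"
        using star by (intro sum.cong) auto
      finally show "card \<F> = (\<Sum>r=1..u. (n - 1) choose (r - 1))" .
    qed
  qed
qed

end
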